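(* Let $S$ and $A$ be finite nonempty sets, let $\pi$ be a policy (a transducer from $S$ to $A$) and let $\varepsilon$ be a teleo-environment (a transducer from $A$ to $S\times\{\bot,\top\}$) such that $\pi$ is optimal for $\varepsilon$. Let $\mathbf a=(a_1,\dots,a_n)\in A^n$ and $\mathbf s=(s_1,\dots,s_n)\in S^n$ be finite sequences such that $((s_1,a_1),\dots,(s_n,a_n))$ is possible for $\pi$ and $((a_1,(s_1,\bot)),\dots,(a_n,(s_n,\bot)))$ is possible for $\varepsilon$. Let $$\pi'=\pi\bullet((s_1,a_1),\dots,(s_n,a_n)),\qquad \varepsilon'=\varepsilon\bullet((a_1,(s_1,\bot)),\dots,(a_n,(s_n,\bot))).$$ Then $\pi'$ is optimal for $\varepsilon'$.
   Context: Transducers. Let $I,O$ be finite sets. A transducer $\tau$ from $I$ to $O$ is (coinductively) a probability distribution $p_\tau$ on $O$ together with, for each $i\in I$ and each $o\in O$ with $p_\tau(o)>0$, another transducer $\tau\bullet(i,o)$ from $I$ to $O$, called "$\tau$ evolved by $(i,o)$". (The output distribution does not depend on the simultaneously received input.) For a finite sequence $h=((i_1,o_1),\dots,(i_n,o_n))$, $n\ge 0$, say that $h$ is possible for $\tau$ if each $o_k$ has positive probability under the output distribution of $\tau\bullet(i_1,o_1)\bullet\cdots\bullet(i_{k-1},o_{k-1})$; then $\tau\bullet h$ denotes the iterated evolution. Two transducers are equal iff they have the same output distributions after every possible sequence $h$ (including the empty one). Policies and teleo-environments. $S$ is the set of sensor values and $A$ the set of actions. A policy is a transducer from $S$ to $A$.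 A teleo-environment is a transducer from $A$ to $S\times\{\bot,\top\}$, where $\top$ is the success signal and $\bot$ the lack-of-success signal; the success signal is not observed by the policy. Coupling. Given a policy $\pi$ and a teleo-environment $\varepsilon$, put $\pi_1=\pi$, $\varepsilon_1=\varepsilon$. At each time step $t=1,2,\dots$ an action $a_t\sim p_{\pi_t}$ and a pair $(s_t,r_t)\sim p_{\varepsilon_t}$ are drawn independently of each other (given the past), and then $\pi_{t+1}=\pi_t\bullet(s_t,a_t)$ and $\varepsilon_{t+1}=\varepsilon_t\bullet(a_t,(s_t,r_t))$. Let $V(\pi,\varepsilon)$ be the probability that $r_t=\top$ for at least one $t\ge 1$. Optimality. A policy $\pi$ is optimal for $\varepsilon$ if $V(\pi,\varepsilon)\ge V(\pi',\varepsilon)$ for every policy $\pi'$. *)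

theory Defs
  imports "HOL-Probability.Probability"
begin

text \<open>
  In a transducer the evolved transducer exists exactly for the outputs of positive probability.
  A codatatype cannot express this dependency, so it is imposed on the coalgebra of
  pairs of a distribution and an arbitrary partial continuation.
  Finiteness of the input and output types is only imposed where it is needed, by sort
  constraints; as types are inhabited, \<^class>\<open>finite\<close> means finite and nonempty.
\<close>

codatatype ('i, 'o) pretransducer =
  Pretransducer (pre_output: "'o pmf") (pre_next: "'i \<Rightarrow> 'o \<Rightarrow> ('i, 'o) pretransducer option")

coinductive wf_pretransducer :: "('i, 'o) pretransducer \<Rightarrow> bool" where
  "(\<And>i y. pre_next \<tau> i y \<noteq> None \<longleftrightarrow> pmf (pre_output \<tau>) y > 0) \<Longrightarrow>
   (\<And>i y \<tau>'. pre_next \<tau> i y = Some \<tau>' \<Longrightarrow> wf_pretransducer \<tau>') \<Longrightarrow>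
   wf_pretransducer \<tau>"

primcorec const_pretransducer :: "'o pmf \<Rightarrow> ('i, 'o) pretransducer" where
  "const_pretransducer p = Pretransducer p
     (\<lambda>i y. map_option (\<lambda>_. const_pretransducer p) (if pmf p y > 0 then Some () else None))"

lemma wf_const_pretransducer: "wf_pretransducer (const_pretransducer p)"
proof (coinduction rule: wf_pretransducer.coinduct)
  case wf_pretransducer
  then show ?case by (auto split: if_splits)
qed

typedef ('i, 'o) transducer = "{\<tau> :: ('i, 'o) pretransducer. wf_pretransducer \<tau>}"
  using wf_const_pretransducer by blast

definition out_dist :: "('i, 'o) transducer \<Rightarrow> 'o pmf" where
  "out_dist \<tau> = pre_output (Rep_transducer \<tau>)"

text \<open>Unspecified when the output in the pair has probability 0.\<close>

definition evolve :: "('i, 'o) transducer \<Rightarrow> 'i \<times> 'o \<Rightarrow> ('i, 'o) transducer" where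
  "evolve \<tau> = (\<lambda>(i, y). Abs_transducer (the (pre_next (Rep_transducer \<tau>) i y)))"

fun possible :: "('i, 'o) transducer \<Rightarrow> ('i \<times> 'o) list \<Rightarrow> bool" where
  "possible \<tau> [] \<longleftrightarrow> True"
| "possible \<tau> ((i, y) # h) \<longleftrightarrow> pmf (out_dist \<tau>) y > 0 \<and> possible (evolve \<tau> (i, y)) h"

definition evolves :: "('i, 'o) transducer \<Rightarrow> ('i \<times> 'o) list \<Rightarrow> ('i, 'o) transducer" where
  "evolves = foldl evolve"

lemma wf_pretransducer_next:
  "wf_pretransducer \<tau> \<Longrightarrow> pre_next \<tau> i y \<noteq> None \<longleftrightarrow> pmf (pre_output \<tau>) y > 0"
  by (erule wf_pretransducer.cases) blast

lemma wf_pretransducer_Some: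
  "wf_pretransducer \<tau> \<Longrightarrow> pre_next \<tau> i y = Some \<tau>' \<Longrightarrow> wf_pretransducer \<tau>'"
  by (erule wf_pretransducer.cases) blast

lemma pre_next_Rep_transducer:
  "pre_next (Rep_transducer \<tau>) i y =
     (if pmf (out_dist \<tau>) y > 0 then Some (Rep_transducer (evolve \<tau> (i, y))) else None)"
proof (cases "pre_next (Rep_transducer \<tau>) i y")
  case None
  then show ?thesis
    using wf_pretransducer_next[of "Rep_transducer \<tau>" i y] Rep_transducer[of \<tau>]
    by (auto simp: out_dist_def)
next
  case (Some \<tau>')
  then show ?thesis
    using wf_pretransducer_next[of "Rep_transducer \<tau>" i y] Rep_transducer[of \<tau>]
      wf_pretransducer_Some[of "Rep_transducer \<tau>" i y \<tau>']
    by (auto simp: out_dist_def evolve_def Abs_transducer_inverse)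
qed

lemma transducer_eqI:
  fixes \<tau> \<sigma> :: "('i, 'o) transducer"
  assumes "\<And>h. possible \<tau> h \<Longrightarrow> possible \<sigma> h \<Longrightarrow> out_dist (evolves \<tau> h) = out_dist (evolves \<sigma> h)"
  shows "\<tau> = \<sigma>"
proof -
  have "Rep_transducer \<tau> = Rep_transducer \<sigma>"
    if "\<forall>h. possible \<tau> h \<longrightarrow> possible \<sigma> h \<longrightarrow> out_dist (evolves \<tau> h) = out_dist (evolves \<sigma> h)"
    for \<tau> \<sigma> :: "('i, 'o) transducer"
    using that
  proof (coinduction arbitrary: \<tau> \<sigma> rule: pretransducer.coinduct)
    case (Eq_pretransducer \<tau> \<sigma>)
    have out: "out_dist \<tau> = out_dist \<sigma>"
      using Eq_pretransducer[rule_format, of "[]"] by (simp add: evolves_def)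
    have step: "out_dist (evolves (evolve \<tau> (i, y)) h) = out_dist (evolves (evolve \<sigma> (i, y)) h)"
      if "pmf (out_dist \<sigma>) y > 0" "possible (evolve \<tau> (i, y)) h" "possible (evolve \<sigma> (i, y)) h"
      for i y h
      using Eq_pretransducer[rule_format, of "(i, y) # h"] that by (simp add: evolves_def out)
    show ?case
      using out
      by (auto simp: rel_fun_def pre_next_Rep_transducer simp flip: out_dist_def, use step in blast)
  qed
  then show ?thesis
    using assms by (simp flip: Rep_transducer_inject)
qed

lemma transducer_exists:
  fixes p :: "'o pmf" and f :: "'i \<Rightarrow> 'o \<Rightarrow> ('i, 'o) transducer"
  shows "\<exists>\<tau>. out_dist \<tau> = p \<and> (\<forall>i y. pmf p y > 0 \<longrightarrow> evolve \<tau> (i, y) = f i y)"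
proof -
  let ?t = "Pretransducer p (\<lambda>i y. if pmf p y > 0 then Some (Rep_transducer (f i y)) else None)"
  have "wf_pretransducer (Rep_transducer \<sigma>)" for \<sigma> :: "('i, 'o) transducer"
    using Rep_transducer[of \<sigma>] by simp
  then have "wf_pretransducer ?t"
    by (auto intro!: wf_pretransducer.intros[of ?t] split: if_splits)
  then show ?thesis
    by (intro exI[of _ "Abs_transducer ?t"])
       (simp add: out_dist_def evolve_def Abs_transducer_inverse Rep_transducer_inverse)
qed

text \<open>The success signal is \<^const>\<open>True\<close>, the lack-of-success signal is \<^const>\<open>False\<close>.\<close>

type_synonym ('s, 'a) policy = "('s, 'a) transducer"
type_synonym ('a, 's) teleo_env = "('a, 's \<times> bool) transducer"

text \<open>
  A trajectory \<open>\<omega>\<close> lists the triples (action, sensor value, success signal),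
  the time steps being numbered from 0.
\<close>

definition policy_at :: "('s, 'a) policy \<Rightarrow> (nat \<Rightarrow> 'a \<times> 's \<times> bool) \<Rightarrow> nat \<Rightarrow> ('s, 'a) policy" where
  "policy_at \<pi> \<omega> t = evolves \<pi> (map (\<lambda>k. case \<omega> k of (a, s, r) \<Rightarrow> (s, a)) [0..<t])"

definition env_at :: "('a, 's) teleo_env \<Rightarrow> (nat \<Rightarrow> 'a \<times> 's \<times> bool) \<Rightarrow> nat \<Rightarrow> ('a, 's) teleo_env" where
  "env_at \<epsilon> \<omega> t = evolves \<epsilon> (map (\<lambda>k. case \<omega> k of (a, s, r) \<Rightarrow> (a, (s, r))) [0..<t])"

definition coupling_step ::
  "('s, 'a) policy \<Rightarrow> ('a, 's) teleo_env \<Rightarrow> nat \<Rightarrow> (nat \<Rightarrow> 'a \<times> 's \<times> bool) \<Rightarrow> ('a \<times> 's \<times> bool) measure" where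
  "coupling_step \<pi> \<epsilon> t \<omega> =
     measure_pmf (pair_pmf (out_dist (policy_at \<pi> \<omega> t)) (out_dist (env_at \<epsilon> \<omega> t)))"

text \<open>The law of the trajectory: the Ionescu-Tulcea extension of the step kernels.\<close>

definition coupling ::
  "('s, 'a) policy \<Rightarrow> ('a, 's) teleo_env \<Rightarrow> (nat \<Rightarrow> 'a \<times> 's \<times> bool) measure" where
  "coupling \<pi> \<epsilon> = projective_family.lim UNIV
     (Ionescu_Tulcea.CI (coupling_step \<pi> \<epsilon>) (\<lambda>_. count_space UNIV)) (\<lambda>_. count_space UNIV)"

definition success_prob :: "('s, 'a) policy \<Rightarrow> ('a, 's) teleo_env \<Rightarrow> real" where
  "success_prob \<pi> \<epsilon> = measure (coupling \<pi> \<epsilon>) {\<omega>. \<exists>t. case \<omega> t of (a, s, r) \<Rightarrow> r}"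

definition optimal :: "('s, 'a) policy \<Rightarrow> ('a, 's) teleo_env \<Rightarrow> bool" where
  "optimal \<pi> \<epsilon> \<longleftrightarrow> (\<forall>\<pi>'. success_prob \<pi> \<epsilon> \<ge> success_prob \<pi>' \<epsilon>)"

lemma Ionescu_Tulcea_coupling_step:
  fixes \<pi> :: "('s::countable, 'a::countable) policy" and \<epsilon> :: "('a, 's) teleo_env"
  shows "Ionescu_Tulcea (coupling_step \<pi> \<epsilon>) (\<lambda>_. count_space UNIV)"
proof (rule Ionescu_Tulcea.intro)
  fix i :: nat
  have "PiM {0..<i} (\<lambda>_. count_space (UNIV :: ('a \<times> 's \<times> bool) set)) =
        count_space (PiE {0..<i} (\<lambda>_. UNIV))"
    by (rule count_space_PiM_finite) auto
  then show "coupling_step \<pi> \<epsilon> i \<in>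
      PiM {0..<i} (\<lambda>_. count_space UNIV) \<rightarrow>\<^sub>M subprob_algebra (count_space UNIV)"
    by (auto simp: coupling_step_def space_subprob_algebra
             intro: measure_pmf.subprob_space_axioms)
next
  show "prob_space (coupling_step \<pi> \<epsilon> i x)" for i x
    unfolding coupling_step_def by (rule measure_pmf.prob_space_axioms)
qed

lemma
  fixes \<pi> :: "('s::countable, 'a::countable) policy" and \<epsilon> :: "('a, 's) teleo_env"
  shows prob_space_coupling: "prob_space (coupling \<pi> \<epsilon>)"
    and sets_coupling: "sets (coupling \<pi> \<epsilon>) = sets (PiM UNIV (\<lambda>_. count_space UNIV))"
    and space_coupling: "space (coupling \<pi> \<epsilon>) = UNIV"
proof -
  interpret IT: Ionescu_Tulcea "coupling_step \<pi> \<epsilon>" "\<lambda>_. count_space UNIV"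
    by (rule Ionescu_Tulcea_coupling_step)
  have "emeasure IT.PF.lim (IT.PF.emb UNIV {} {\<lambda>_. undefined}) = emeasure (IT.CI {}) {\<lambda>_. undefined}"
    by (rule IT.lim) (auto simp: PiM_empty)
  moreover have "emeasure (IT.CI {}) (space (IT.CI {})) = 1"
    by (rule prob_space.emeasure_space_1) (rule IT.PF.prob_space_P, auto)
  moreover have "space (IT.CI {}) = {\<lambda>_. undefined}"
    by (simp add: IT.CI_def space_PiM)
  moreover have "IT.PF.emb UNIV {} {\<lambda>_. undefined} = UNIV"
    by (auto simp: prod_emb_def space_PiM restrict_def)
  ultimately have "emeasure IT.PF.lim UNIV = 1"
    by simp
  then show "prob_space (coupling \<pi> \<epsilon>)"
    unfolding coupling_def by (intro prob_spaceI) (simp add: space_PiM)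
  show "sets (coupling \<pi> \<epsilon>) = sets (PiM UNIV (\<lambda>_. count_space UNIV))"
    unfolding coupling_def by simp
  show "space (coupling \<pi> \<epsilon>) = UNIV"
    unfolding coupling_def by (simp add: space_PiM)
qed

lemma emeasure_coupling_prefix:
  fixes \<pi> :: "('s::countable, 'a::countable) policy" and \<epsilon> :: "('a, 's) teleo_env"
  shows "emeasure (coupling \<pi> \<epsilon>) {\<omega>. \<forall>k<n. \<omega> k = h k} =
    (\<Prod>k<n. ennreal (pmf (out_dist (policy_at \<pi> h k)) (fst (h k)) *
                     pmf (out_dist (env_at \<epsilon> h k)) (snd (h k))))"
proof -
  interpret IT: Ionescu_Tulcea "coupling_step \<pi> \<epsilon>" "\<lambda>_. count_space UNIV"
    by (rule Ionescu_Tulcea_coupling_step)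
  let ?M = "\<lambda>_::nat. count_space (UNIV :: ('a \<times> 's \<times> bool) set)"
  have PiM_eq: "PiM {0..<m} ?M = count_space (PiE {0..<m} (\<lambda>_. UNIV))" for m
    by (rule count_space_PiM_finite) auto
  let ?h = "\<lambda>m. restrict h {0..<m}"
  have sets1: "{?h m} \<in> sets (PiM {0..<m} ?M)" for m
    by (auto simp: PiM_eq)
  have C: "emeasure (IT.C 0 m (\<lambda>_. undefined)) {?h m} =
    (\<Prod>k<m. ennreal (pmf (out_dist (policy_at \<pi> h k)) (fst (h k)) *
                     pmf (out_dist (env_at \<epsilon> h k)) (snd (h k))))" for m
  proof (induction m)
    case 0
    have "?h 0 = (\<lambda>_. undefined)" by auto
    then show ?case
      by (simp add: PiM_empty)
  next
    case (Suc m)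
    have sp: "space (IT.C 0 m (\<lambda>_. undefined)) = PiE {0..<m} (\<lambda>_. UNIV)"
      by (subst IT.space_C) (auto simp: space_PiM)
    have setsC: "sets (IT.C 0 m (\<lambda>_. undefined)) = sets (PiM {0..<m} ?M)"
      using IT.sets_C[of "\<lambda>_. undefined" 0 m] by (simp add: space_PiM)
    let ?p = "ennreal (pmf (out_dist (policy_at \<pi> h m)) (fst (h m)) *
                     pmf (out_dist (env_at \<epsilon> h m)) (snd (h m)))"
    have eP: "emeasure (IT.eP m x) {?h (Suc m)} = ?p * indicator {?h m} x"
      if x: "x \<in> PiE {0..<m} (\<lambda>_. UNIV)" for x
    proof -
      have "emeasure (IT.eP m x) {?h (Suc m)} =
        emeasure (coupling_step \<pi> \<epsilon> m x) ((\<lambda>y. x(m := y)) -` {?h (Suc m)} \<inter> UNIV)"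
        using x sets1[of "Suc m"] by (subst IT.emeasure_eP) (auto simp: space_PiM)
      also have "(\<lambda>y. x(m := y)) -` {?h (Suc m)} \<inter> UNIV = (if x = ?h m then {h m} else {})"
      proof -
        have "x(m := y) = ?h (Suc m) \<longleftrightarrow> x = ?h m \<and> y = h m" for y
        proof
          assume eq: "x(m := y) = ?h (Suc m)"
          have "x k = ?h m k" for k
            using fun_cong[OF eq, of k] x by (cases "k = m") (auto simp: PiE_def extensional_def)
          then show "x = ?h m \<and> y = h m"
            using fun_cong[OF eq, of m] by auto
        qed (auto simp: fun_eq_iff)
        then show ?thesis by auto
      qed
      also have "emeasure (coupling_step \<pi> \<epsilon> m x) (if x = ?h m then {h m} else {}) =
          ?p * indicator {?h m} x"
      proof -
        have "map (\<lambda>k. case ?h m k of (a, s, r) \<Rightarrow> (s, a)) [0..<m] =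
              map (\<lambda>k. case h k of (a, s, r) \<Rightarrow> (s, a)) [0..<m]"
          and "map (\<lambda>k. case ?h m k of (a, s, r) \<Rightarrow> (a, (s, r))) [0..<m] =
              map (\<lambda>k. case h k of (a, s, r) \<Rightarrow> (a, (s, r))) [0..<m]"
          by auto
        then have "policy_at \<pi> (?h m) m = policy_at \<pi> h m" "env_at \<epsilon> (?h m) m = env_at \<epsilon> h m"
          by (simp_all only: policy_at_def env_at_def)
        moreover have "pmf (pair_pmf P Q) (h m) = pmf P (fst (h m)) * pmf Q (snd (h m))" for P Q
          by (metis pmf_pair prod.collapse)
        ultimately show ?thesis
          by (simp add: coupling_step_def emeasure_pmf_single)
      qed
      finally show ?thesis .
    qed
    have "emeasure (IT.C 0 (Suc m) (\<lambda>_. undefined)) {?h (Suc m)} =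
        (\<integral>\<^sup>+x. emeasure (IT.eP m x) {?h (Suc m)} \<partial>IT.C 0 m (\<lambda>_. undefined))"
    proof -
      have meas: "IT.eP m \<in> IT.C 0 m (\<lambda>_. undefined) \<rightarrow>\<^sub>M subprob_algebra (PiM {0..<Suc m} ?M)"
        using IT.measurable_eP[of m] by (subst measurable_cong_sets[OF setsC refl])
      have ne: "space (IT.C 0 m (\<lambda>_. undefined)) \<noteq> {}"
        unfolding sp by (simp add: PiE_eq_empty_iff)
      show ?thesis
        unfolding IT.C.simps add_0 by (rule emeasure_bind[OF ne meas sets1])
    qed
    also have "\<dots> = (\<integral>\<^sup>+x. ?p * indicator {?h m} x \<partial>IT.C 0 m (\<lambda>_. undefined))"
      by (intro nn_integral_cong) (simp add: eP sp)
    also have "\<dots> = ?p * emeasure (IT.C 0 m (\<lambda>_. undefined)) {?h m}"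
      using sets1[of m] by (subst nn_integral_cmult_indicator) (auto simp: setsC)
    finally show ?case
      by (simp only: Suc prod.lessThan_Suc mult.commute)
  qed
  have "restrict \<omega> {0..<n} = ?h n \<longleftrightarrow> (\<forall>k<n. \<omega> k = h k)" for \<omega>
  proof
    assume eq: "restrict \<omega> {0..<n} = ?h n"
    show "\<forall>k<n. \<omega> k = h k"
    proof (intro allI impI)
      fix k assume "k < n"
      then show "\<omega> k = h k"
        using fun_cong[OF eq, of k] by simp
    qed
  next
    assume "\<forall>k<n. \<omega> k = h k"
    then show "restrict \<omega> {0..<n} = ?h n"
      by (intro restrict_ext) simp
  qed
  then have "{\<omega>. \<forall>k<n. \<omega> k = h k} = IT.PF.emb UNIV {0..<n} {?h n}"
    by (simp add: prod_emb_def space_PiM vimage_def)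
  then have "emeasure (coupling \<pi> \<epsilon>) {\<omega>. \<forall>k<n. \<omega> k = h k} = emeasure (IT.CI {0..<n}) {?h n}"
    unfolding coupling_def using IT.lim[OF _ sets1[of n]] by simp
  also have "\<dots> = emeasure (IT.C 0 n (\<lambda>_. undefined)) (IT.PF.emb {0..<n} {0..<n} {?h n})"
    by (rule IT.emeasure_CI) (auto simp: sets1)
  also have "IT.PF.emb {0..<n} {0..<n} {?h n} = {?h n}"
    by (rule prod_emb_id) (auto simp: space_PiM)
  finally show ?thesis
    by (simp add: C)
qed

lemma sets_success:
  fixes \<pi> :: "('s::countable, 'a::countable) policy" and \<epsilon> :: "('a, 's) teleo_env"
  shows "{\<omega>. \<exists>t. case \<omega> t of (a, s, r) \<Rightarrow> r} \<in> sets (coupling \<pi> \<epsilon>)"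
proof -
  have "(\<lambda>\<omega>. case \<omega> t of (a, s, r) \<Rightarrow> r) \<in>
      PiM UNIV (\<lambda>_::nat. count_space (UNIV :: ('a \<times> 's \<times> bool) set)) \<rightarrow>\<^sub>M count_space UNIV" for t
    by (rule measurable_compose[OF measurable_component_singleton]) auto
  then have "{\<omega> \<in> space (PiM UNIV (\<lambda>_::nat. count_space (UNIV :: ('a \<times> 's \<times> bool) set))).
      \<exists>t. case \<omega> t of (a, s, r) \<Rightarrow> r} \<in> sets (PiM UNIV (\<lambda>_. count_space UNIV))"
    by measurable
  then show ?thesis
    by (simp add: sets_coupling space_PiM)
qed

end

theory Submission
  imports Defs
begin

text \<open>
  The probability of never succeeding satisfies a Bellman equation: it is the sum, over all pairs
  of an action \<open>a\<close> and a sensor value \<open>s\<close>, of the probability that the first step is \<open>a\<close>, \<open>s\<close> without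
  success times the probability that the coupling evolved by this step never succeeds
  (\<open>failure_prob_Bellman\<close>).  A first step with success contributes nothing, so it does not matter
  that the policy cannot tell whether the success signal has occurred.

  Hence a better policy \<open>\<rho>\<close> for the environment evolved by one possible unsuccessful step \<open>a\<close>, \<open>s\<close>
  would give a better policy for the original environment: act as before, but continue with \<open>\<rho>\<close> after
  \<open>a\<close>, \<open>s\<close>.  Only the summand of \<open>a\<close>, \<open>s\<close> changes, and its weight is positive.  So optimality is
  inherited by one possible step without success (\<open>optimal_evolve\<close>), and induction extends
  this to finitely many.

  The Bellman equation itself is first shown for the event of no success before time \<open>n\<close>.
  This event is a finite disjoint union of cylinders, whose probabilities are products over the time
  steps, and the first factor can be split off (\<open>coupling_cylinder_Cons\<close>).  The limit \<open>n \<rightarrow> \<infinity>\<close> then passes through the finite sum.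
\<close>

lemma coupling_cylinder_Cons:
  fixes \<pi> :: "('s::countable, 'a::countable) policy" and \<epsilon> :: "('a, 's) teleo_env"
  shows "measure (coupling \<pi> \<epsilon>) {\<omega>. \<forall>k<Suc (length xs). \<omega> k = ((a, s, r) # xs) ! k} =
    pmf (out_dist \<pi>) a * pmf (out_dist \<epsilon>) (s, r) *
    measure (coupling (evolve \<pi> (s, a)) (evolve \<epsilon> (a, s, r))) {\<omega>. \<forall>k<length xs. \<omega> k = xs ! k}"
proof -
  have "policy_at \<pi> ((!) ((a, s, r) # xs)) (Suc k) = policy_at (evolve \<pi> (s, a)) ((!) xs) k"
    and "env_at \<epsilon> ((!) ((a, s, r) # xs)) (Suc k) = env_at (evolve \<epsilon> (a, s, r)) ((!) xs) k" for k
    by (simp_all add: policy_at_def env_at_def evolves_def map_upt_Suc del: upt_Suc)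
  moreover have "policy_at \<pi> \<omega> 0 = \<pi>" "env_at \<epsilon> \<omega> 0 = \<epsilon>" for \<omega>
    by (simp_all add: policy_at_def env_at_def evolves_def)
  ultimately show ?thesis
    unfolding measure_def emeasure_coupling_prefix prod.lessThan_Suc_shift
    by (simp add: enn2real_mult)
qed

definition failure_lists :: "nat \<Rightarrow> ('a \<times> 's \<times> bool) list set" where
  "failure_lists n = {xs. length xs = n \<and> (\<forall>(a, s, r) \<in> set xs. \<not> r)}"

lemma finite_failure_lists: "finite (failure_lists n :: ('a::finite \<times> 's::finite \<times> bool) list set)"
  by (rule finite_subset[OF _ finite_lists_length_eq[of UNIV n]]) (auto simp: failure_lists_def)

lemma bij_betw_failure_lists_Suc:
  "bij_betw (\<lambda>((a, s), xs). (a, s, False) # xs) (UNIV \<times> failure_lists n) (failure_lists (Suc n))"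
  by (auto simp: bij_betw_def inj_on_def failure_lists_def length_Suc_conv image_iff)

definition failure_before_prob :: "nat \<Rightarrow> ('s, 'a) policy \<Rightarrow> ('a, 's) teleo_env \<Rightarrow> real" where
  "failure_before_prob n \<pi> \<epsilon> = measure (coupling \<pi> \<epsilon>) {\<omega>. \<forall>t<n. case \<omega> t of (a, s, r) \<Rightarrow> \<not> r}"

definition failure_prob :: "('s, 'a) policy \<Rightarrow> ('a, 's) teleo_env \<Rightarrow> real" where
  "failure_prob \<pi> \<epsilon> = measure (coupling \<pi> \<epsilon>) {\<omega>. \<forall>t. case \<omega> t of (a, s, r) \<Rightarrow> \<not> r}"

lemma sets_coupling_cylinder:
  fixes \<pi> :: "('s::countable, 'a::countable) policy" and \<epsilon> :: "('a, 's) teleo_env"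
  shows "{\<omega>. \<forall>k<n. \<omega> k = h k} \<in> sets (coupling \<pi> \<epsilon>)"
proof -
  have "{\<omega> \<in> space (PiM UNIV (\<lambda>_::nat. count_space (UNIV :: ('a \<times> 's \<times> bool) set))).
      \<forall>k<n. \<omega> k = h k} \<in> sets (PiM UNIV (\<lambda>_. count_space UNIV))"
    by measurable
  then show ?thesis
    by (simp add: sets_coupling space_PiM)
qed

text \<open>
  The law of the trajectory is only known on cylinders, so the event is split by the prefix of
  length \<open>n\<close>.  Finiteness of the action and sensor sets keeps the union finite, which is what makes
  the recursion and its limit plain sums.
\<close>

lemma failure_before_eq_Union_cylinders:
  "{\<omega>. \<forall>t<n. case \<omega> t of (a, s, r) \<Rightarrow> \<not> r} = (\<Union>xs\<in>failure_lists n. {\<omega>. \<forall>k<length xs. \<omega> k = xs ! k})"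
  (is "?F = ?U")
proof (intro equalityI subsetI)
  fix \<omega> :: "nat \<Rightarrow> 'a \<times> 'b \<times> bool"
  assume "\<omega> \<in> ?F"
  then have "map \<omega> [0..<n] \<in> failure_lists n"
    by (auto simp: failure_lists_def)
  then show "\<omega> \<in> ?U"
    by (intro UN_I[of "map \<omega> [0..<n]"]) auto
next
  fix \<omega> :: "nat \<Rightarrow> 'a \<times> 'b \<times> bool"
  assume "\<omega> \<in> ?U"
  then show "\<omega> \<in> ?F"
    unfolding failure_lists_def using nth_mem by fastforce
qed

lemma disjoint_failure_cylinders:
  "disjoint_family_on (\<lambda>xs. {\<omega>. \<forall>k<length xs. \<omega> k = xs ! k}) (failure_lists n)"
  by (auto simp: disjoint_family_on_def failure_lists_def intro!: nth_equalityI)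

lemma failure_before_prob_eq_sum:
  fixes \<pi> :: "('s::finite, 'a::finite) policy" and \<epsilon> :: "('a, 's) teleo_env"
  shows "failure_before_prob n \<pi> \<epsilon> =
    (\<Sum>xs\<in>failure_lists n. measure (coupling \<pi> \<epsilon>) {\<omega>. \<forall>k<length xs. \<omega> k = xs ! k})"
proof -
  interpret prob_space "coupling \<pi> \<epsilon>" by (rule prob_space_coupling)
  show ?thesis
    unfolding failure_before_prob_def failure_before_eq_Union_cylinders
    by (intro finite_measure_finite_Union finite_failure_lists disjoint_failure_cylinders)
       (auto intro: sets_coupling_cylinder)
qed

lemma failure_before_prob_Suc:
  fixes \<pi> :: "('s::finite, 'a::finite) policy" and \<epsilon> :: "('a, 's) teleo_env"
  shows "failure_before_prob (Suc n) \<pi> \<epsilon> =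
    (\<Sum>(a, s)\<in>UNIV. pmf (out_dist \<pi>) a * pmf (out_dist \<epsilon>) (s, False) *
      failure_before_prob n (evolve \<pi> (s, a)) (evolve \<epsilon> (a, s, False)))"
proof -
  have "failure_before_prob (Suc n) \<pi> \<epsilon> =
    (\<Sum>((a, s), xs)\<in>UNIV \<times> failure_lists n.
      measure (coupling \<pi> \<epsilon>) {\<omega>. \<forall>k<Suc (length xs). \<omega> k = ((a, s, False) # xs) ! k})"
    unfolding failure_before_prob_eq_sum
    by (subst sum.reindex_bij_betw[OF bij_betw_failure_lists_Suc, symmetric])
       (simp add: case_prod_unfold)
  also have "\<dots> = (\<Sum>(a, s)\<in>UNIV. \<Sum>xs\<in>failure_lists n.
      pmf (out_dist \<pi>) a * pmf (out_dist \<epsilon>) (s, False) *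
      measure (coupling (evolve \<pi> (s, a)) (evolve \<epsilon> (a, s, False))) {\<omega>. \<forall>k<length xs. \<omega> k = xs ! k})"
    unfolding sum.cartesian_product' case_prod_unfold fst_conv snd_conv coupling_cylinder_Cons ..
  finally show ?thesis
    unfolding failure_before_prob_eq_sum[of n] sum_distrib_left .
qed

lemma failure_before_prob_tendsto:
  fixes \<pi> :: "('s::finite, 'a::finite) policy" and \<epsilon> :: "('a, 's) teleo_env"
  shows "(\<lambda>n. failure_before_prob n \<pi> \<epsilon>) \<longlonglongrightarrow> failure_prob \<pi> \<epsilon>"
proof -
  let ?F = "\<lambda>n. {\<omega> :: nat \<Rightarrow> 'a \<times> 's \<times> bool. \<forall>t<n. case \<omega> t of (a, s, r) \<Rightarrow> \<not> r}"
  interpret prob_space "coupling \<pi> \<epsilon>" by (rule prob_space_coupling)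
  have "range ?F \<subseteq> sets (coupling \<pi> \<epsilon>)"
    unfolding failure_before_eq_Union_cylinders
    by (intro image_subsetI sets.finite_UN finite_failure_lists sets_coupling_cylinder)
  moreover have "decseq ?F"
    by (auto simp: decseq_def case_prod_unfold)
  ultimately have "(\<lambda>n. prob (?F n)) \<longlonglongrightarrow> prob (\<Inter>n. ?F n)"
    by (rule finite_Lim_measure_decseq)
  moreover have "(\<Inter>n. ?F n) = {\<omega>. \<forall>t. case \<omega> t of (a, s, r) \<Rightarrow> \<not> r}"
    unfolding set_eq_iff INT_iff mem_Collect_eq by (metis UNIV_I lessI)
  ultimately show ?thesis
    by (simp add: failure_before_prob_def failure_prob_def)
qed

lemma failure_prob_Bellman:
  fixes \<pi> :: "('s::finite, 'a::finite) policy" and \<epsilon> :: "('a, 's) teleo_env"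
  shows "failure_prob \<pi> \<epsilon> =
    (\<Sum>(a, s)\<in>UNIV. pmf (out_dist \<pi>) a * pmf (out_dist \<epsilon>) (s, False) *
      failure_prob (evolve \<pi> (s, a)) (evolve \<epsilon> (a, s, False)))"
    (is "_ = ?R")
proof (rule LIMSEQ_unique)
  show "(\<lambda>n. failure_before_prob (Suc n) \<pi> \<epsilon>) \<longlonglongrightarrow> failure_prob \<pi> \<epsilon>"
    by (rule LIMSEQ_Suc[OF failure_before_prob_tendsto])
  show "(\<lambda>n. failure_before_prob (Suc n) \<pi> \<epsilon>) \<longlonglongrightarrow> ?R"
    unfolding failure_before_prob_Suc case_prod_unfold
    by (intro tendsto_intros failure_before_prob_tendsto)
qed

lemma success_prob_eq_failure_prob:
  fixes \<pi> :: "('s::countable, 'a::countable) policy" and \<epsilon> :: "('a, 's) teleo_env"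
  shows "success_prob \<pi> \<epsilon> = 1 - failure_prob \<pi> \<epsilon>"
proof -
  interpret prob_space "coupling \<pi> \<epsilon>" by (rule prob_space_coupling)
  have "{\<omega> :: nat \<Rightarrow> 'a \<times> 's \<times> bool. \<forall>t. case \<omega> t of (a, s, r) \<Rightarrow> \<not> r} =
      space (coupling \<pi> \<epsilon>) - {\<omega>. \<exists>t. case \<omega> t of (a, s, r) \<Rightarrow> r}"
    by (auto simp: space_coupling case_prod_unfold)
  then show ?thesis
    unfolding success_prob_def failure_prob_def by (simp add: prob_compl sets_success)
qed

lemma optimal_iff_failure_prob_le:
  fixes \<pi> :: "('s::countable, 'a::countable) policy" and \<epsilon> :: "('a, 's) teleo_env"
  shows "optimal \<pi> \<epsilon> \<longleftrightarrow> (\<forall>\<rho>. failure_prob \<pi> \<epsilon> \<le> failure_prob \<rho> \<epsilon>)"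
  by (simp add: optimal_def success_prob_eq_failure_prob)

text \<open>
  Replacing the continuation of an optimal policy after one pair of a sensor value and an action
  changes a single summand of the Bellman equation, and so must not decrease this summand.
\<close>

lemma optimal_evolve:
  fixes \<pi> :: "('s::finite, 'a::finite) policy" and \<epsilon> :: "('a, 's) teleo_env"
  assumes opt: "optimal \<pi> \<epsilon>"
    and a: "pmf (out_dist \<pi>) a > 0" and s: "pmf (out_dist \<epsilon>) (s, False) > 0"
  shows "optimal (evolve \<pi> (s, a)) (evolve \<epsilon> (a, s, False))"
  unfolding optimal_iff_failure_prob_le
proof
  fix \<rho>
  let ?w = "\<lambda>a s. pmf (out_dist \<pi>) a * pmf (out_dist \<epsilon>) (s, False)"
  let ?f = "\<lambda>\<pi> (a, s). ?w a s * failure_prob (evolve \<pi> (s, a)) (evolve \<epsilon> (a, s, False))"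
  obtain \<pi>' where out: "out_dist \<pi>' = out_dist \<pi>"
    and evolve: "\<And>i y. pmf (out_dist \<pi>) y > 0 \<Longrightarrow>
      evolve \<pi>' (i, y) = (if (i, y) = (s, a) then \<rho> else evolve \<pi> (i, y))"
    using transducer_exists[of "out_dist \<pi>" "\<lambda>i y. if (i, y) = (s, a) then \<rho> else evolve \<pi> (i, y)"]
    by auto
  \<comment> \<open>An action of probability 0, after which the evolution of \<open>\<pi>'\<close> is unspecified, has weight 0.\<close>
  have same: "?f \<pi>' x = ?f \<pi> x" if "x \<noteq> (a, s)" for x
  proof (cases x)
    case (Pair b u)
    then show ?thesis
      using that evolve[of b u] pmf_nonneg[of "out_dist \<pi>" b] by (cases "pmf (out_dist \<pi>) b = 0") auto
  qed
  have "sum (?f \<pi>) UNIV \<le> sum (?f \<pi>') UNIV"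
    using opt[unfolded optimal_iff_failure_prob_le, rule_format, of \<pi>']
    unfolding failure_prob_Bellman[of \<pi> \<epsilon>] failure_prob_Bellman[of \<pi>' \<epsilon>] out .
  also have "sum (?f \<pi>') UNIV = ?f \<pi>' (a, s) + sum (?f \<pi>) (UNIV - {(a, s)})"
    unfolding sum.remove[OF finite UNIV_I[of "(a, s)"], of "?f \<pi>'"]
    by (intro arg_cong2[where f = "(+)"] sum.cong) (use same in auto)
  also have "sum (?f \<pi>) UNIV = ?f \<pi> (a, s) + sum (?f \<pi>) (UNIV - {(a, s)})"
    by (rule sum.remove) auto
  finally have "?f \<pi> (a, s) \<le> ?f \<pi>' (a, s)"
    by simp
  moreover have "?w a s > 0"
    using a s by simp
  ultimately show "failure_prob (evolve \<pi> (s, a)) (evolve \<epsilon> (a, s, False)) \<le>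
      failure_prob \<rho> (evolve \<epsilon> (a, s, False))"
    using evolve[OF a, of s] by (simp add: mult_le_cancel_left_pos)
qed

theorem corollary5p0p3:
  fixes \<pi> :: "('s::finite, 'a::finite) policy"
    and \<epsilon> :: "('a, 's) teleo_env"
    and n :: nat
    and as :: "'a list"
    and ss :: "'s list"
  assumes "optimal \<pi> \<epsilon>"
    and "length as = n" and "length ss = n"
    and "possible \<pi> (zip ss as)"
    and "possible \<epsilon> (zip as (map (\<lambda>s. (s, False)) ss))"
  shows "optimal (evolves \<pi> (zip ss as)) (evolves \<epsilon> (zip as (map (\<lambda>s. (s, False)) ss)))"
proof -
  have "length as = length ss"
    using assms(2,3) by simp
  then show ?thesis
    using assms(1,4,5)
  proof (induction as ss arbitrary: \<pi> \<epsilon> rule: list_induct2)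
    case Nil
    then show ?case
      by (simp add: evolves_def)
  next
    case (Cons a as s ss)
    then show ?case
      using Cons.IH[of "evolve \<pi> (s, a)" "evolve \<epsilon> (a, s, False)"] optimal_evolve[of \<pi> \<epsilon> a s]
      by (simp add: evolves_def)
  qed
qed

end
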